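(* Let $\mathcal C$ be a category and $K$ any covering function on $\mathcal C$. Then $$(\overline K)_{Sat}=\overline{K_{Sat}}.$$ This covering function, denoted $J_K$, is characterized by the following property: for any sieve $S$, $S\in J_K$ if and only if $S$ contains a $K$-covering.
   Context: A covering of an object $C$ is a class of arrows with codomain $C$. A covering function $K$ on $\mathcal C$ assigns to each object $C$ a collection $K(C)$ of coverings of $C$; its members are called $K$-coverings, and "$R\in K$" means $R\in K(C)$ for the object $C$ that $R$ covers. A covering $R$ of $C$ refines a covering $S$ of $C$ if each arrow of $R$ factors through some arrow of $S$. A sieve on $C$ is a covering of $C$ closed under precomposition with arbitrary composable arrows. The sieve generated by a covering $R$ is $\overline R=\{f\circ g\mid f\in R,\ g \text{ composable with } f\}$. The covering function $\overline K$ has as coverings the sieves generated by the $K$-coverings. A covering function is sifted if all its coverings are sieves. For a general covering function $K$, the saturation $K_{Sat}$ is the covering function whose coverings are all coverings having a refinement in $K$. For the sifted covering function $\overline K$, $(\overline K)_{Sat}$ denotes its sifted saturation: the covering function whose coverings are all sieves containing a $\overline K$-sieve. "$S$ contains a $K$-covering", for a sieve $S$ on $C$, means that there is $R\in K(C)$ with $R\subset S$. *)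

theory Defs
  imports Main "HOL-Library.FuncSet"
begin

record ('o, 'a) category =
  Obj :: "'o set"
  Arr :: "'a set"
  Dom :: "'a \<Rightarrow> 'o"
  Cod :: "'a \<Rightarrow> 'o"
  Id :: "'o \<Rightarrow> 'a"
  Comp :: "'a \<Rightarrow> 'a \<Rightarrow> 'a"  (infixl "\<cdot>\<index>" 70)

text \<open>Composition is written in the usual order: \<open>f \<cdot> g\<close> is \<open>f\<close> after \<open>g\<close> and is meaningful
  only when the domain of \<open>f\<close> is the codomain of \<open>g\<close>.\<close>

locale category =
  fixes \<C> :: "('o, 'a) category" (structure)
  assumes Dom_closed: "f \<in> Arr \<C> \<Longrightarrow> Dom \<C> f \<in> Obj \<C>"
    and Cod_closed: "f \<in> Arr \<C> \<Longrightarrow> Cod \<C> f \<in> Obj \<C>"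
    and Id_closed: "X \<in> Obj \<C> \<Longrightarrow> Id \<C> X \<in> Arr \<C>"
    and Dom_Id: "X \<in> Obj \<C> \<Longrightarrow> Dom \<C> (Id \<C> X) = X"
    and Cod_Id: "X \<in> Obj \<C> \<Longrightarrow> Cod \<C> (Id \<C> X) = X"
    and Comp_closed: "\<lbrakk>f \<in> Arr \<C>; g \<in> Arr \<C>; Dom \<C> f = Cod \<C> g\<rbrakk> \<Longrightarrow> f \<cdot> g \<in> Arr \<C>"
    and Dom_Comp: "\<lbrakk>f \<in> Arr \<C>; g \<in> Arr \<C>; Dom \<C> f = Cod \<C> g\<rbrakk> \<Longrightarrow> Dom \<C> (f \<cdot> g) = Dom \<C> g"
    and Cod_Comp: "\<lbrakk>f \<in> Arr \<C>; g \<in> Arr \<C>; Dom \<C> f = Cod \<C> g\<rbrakk> \<Longrightarrow> Cod \<C> (f \<cdot> g) = Cod \<C> f"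
    and Comp_Id_left: "f \<in> Arr \<C> \<Longrightarrow> Id \<C> (Cod \<C> f) \<cdot> f = f"
    and Comp_Id_right: "f \<in> Arr \<C> \<Longrightarrow> f \<cdot> Id \<C> (Dom \<C> f) = f"
    and Comp_assoc: "\<lbrakk>f \<in> Arr \<C>; g \<in> Arr \<C>; h \<in> Arr \<C>; Dom \<C> f = Cod \<C> g; Dom \<C> g = Cod \<C> h\<rbrakk>
      \<Longrightarrow> (f \<cdot> g) \<cdot> h = f \<cdot> (g \<cdot> h)"

definition coverings :: "('o, 'a) category \<Rightarrow> 'o \<Rightarrow> 'a set set" where
  "coverings \<C> X = Pow {f \<in> Arr \<C>. Cod \<C> f = X}"

text \<open>Covering functions are taken to be extensional, that is \<^const>\<open>undefined\<close> off the objects,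
  so that HOL equality of covering functions is equality at all objects.\<close>

definition covering_functions :: "('o, 'a) category \<Rightarrow> ('o \<Rightarrow> 'a set set) set" where
  "covering_functions \<C> = (\<Pi>\<^sub>E X \<in> Obj \<C>. Pow (coverings \<C> X))"

text \<open>\<open>refines \<C> R S\<close> is intended for coverings \<open>R\<close> and \<open>S\<close> of the same object.\<close>

definition refines :: "('o, 'a) category \<Rightarrow> 'a set \<Rightarrow> 'a set \<Rightarrow> bool" where
  "refines \<C> R S \<longleftrightarrow>
    (\<forall>f\<in>R. \<exists>g\<in>S. \<exists>h\<in>Arr \<C>. Dom \<C> g = Cod \<C> h \<and> f = g \<cdot>\<^bsub>\<C>\<^esub> h)"

definition sieves :: "('o, 'a) category \<Rightarrow> 'o \<Rightarrow> 'a set set" where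
  "sieves \<C> X = {S \<in> coverings \<C> X.
    \<forall>f\<in>S. \<forall>g\<in>Arr \<C>. Dom \<C> f = Cod \<C> g \<longrightarrow> f \<cdot>\<^bsub>\<C>\<^esub> g \<in> S}"

definition generated_sieve :: "('o, 'a) category \<Rightarrow> 'a set \<Rightarrow> 'a set" where
  "generated_sieve \<C> R = {f \<cdot>\<^bsub>\<C>\<^esub> g | f g. f \<in> R \<and> g \<in> Arr \<C> \<and> Dom \<C> f = Cod \<C> g}"

definition sieve_closure ::
  "('o, 'a) category \<Rightarrow> ('o \<Rightarrow> 'a set set) \<Rightarrow> 'o \<Rightarrow> 'a set set" where
  "sieve_closure \<C> K = (\<lambda>X\<in>Obj \<C>. generated_sieve \<C> ` K X)"

definition sifted_covering_functions :: "('o, 'a) category \<Rightarrow> ('o \<Rightarrow> 'a set set) set" where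
  "sifted_covering_functions \<C> =
    {K \<in> covering_functions \<C>. \<forall>X\<in>Obj \<C>. K X \<subseteq> sieves \<C> X}"

definition saturation ::
  "('o, 'a) category \<Rightarrow> ('o \<Rightarrow> 'a set set) \<Rightarrow> 'o \<Rightarrow> 'a set set" where
  "saturation \<C> K = (\<lambda>X\<in>Obj \<C>. {S \<in> coverings \<C> X. \<exists>R\<in>K X. refines \<C> R S})"

definition sifted_saturation ::
  "('o, 'a) category \<Rightarrow> ('o \<Rightarrow> 'a set set) \<Rightarrow> 'o \<Rightarrow> 'a set set" where
  "sifted_saturation \<C> L = (\<lambda>X\<in>Obj \<C>. {S \<in> sieves \<C> X. \<exists>R\<in>L X. R \<subseteq> S})"

definition J_cov ::
  "('o, 'a) category \<Rightarrow> ('o \<Rightarrow> 'a set set) \<Rightarrow> 'o \<Rightarrow> 'a set set" where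
  "J_cov \<C> K = sifted_saturation \<C> (sieve_closure \<C> K)"

end

theory Submission
  imports Defs
begin

text \<open>
  The operation \<open>R \<mapsto> generated_sieve \<C> R\<close> is a closure operator on the coverings of an object,
  and its closed sets are exactly the sieves: a sieve contains \<open>R\<close> iff it contains the sieve
  generated by \<open>R\<close> (lemma \<open>generated_sieve_subset_iff\<close>).  Moreover refinement is inclusion up to this
  closure: \<open>R\<close> refines \<open>S\<close> iff \<open>R \<subseteq> generated_sieve \<C> S\<close> (lemma \<open>refines_iff_subset_generated_sieve\<close>).

  Both sides of the claimed equality therefore have as coverings of \<open>X\<close> the sieves that contain a
  member of \<open>K X\<close>.  On the left, a sieve contains the closure of some \<open>R \<in> K X\<close> iff it contains
  \<open>R\<close> itself.  On the right, the coverings are the closures of those \<open>S\<close> whose closure contains some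
  \<open>R \<in> K X\<close>; since closures are sieves and every sieve is its own closure, these are again all the
  sieves containing some \<open>R \<in> K X\<close>.  The property determines \<open>J_cov \<C> K\<close> because a sifted covering
  function is determined by which sieves are members.
\<close>

lemma coverings_subset_Arr: "R \<in> coverings \<C> X \<Longrightarrow> R \<subseteq> Arr \<C>"
  by (auto simp: coverings_def)

lemma sieve_in_coverings: "S \<in> sieves \<C> X \<Longrightarrow> S \<in> coverings \<C> X"
  by (auto simp: sieves_def)

lemma covering_functionsD:
  "\<lbrakk>K \<in> covering_functions \<C>; X \<in> Obj \<C>; R \<in> K X\<rbrakk> \<Longrightarrow> R \<in> coverings \<C> X"
  by (auto simp: covering_functions_def PiE_iff)

text \<open>Both sides say that every arrow of \<open>R\<close> factors through an arrow of \<open>S\<close>; this form lets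
  refinement be handled by the closure properties of \<^const>\<open>generated_sieve\<close> alone.\<close>

lemma refines_iff_subset_generated_sieve: "refines \<C> R S \<longleftrightarrow> R \<subseteq> generated_sieve \<C> S"
  unfolding refines_def generated_sieve_def subset_iff by blast

context category
begin

lemma subset_generated_sieve:
  assumes "R \<subseteq> Arr \<C>"
  shows "R \<subseteq> generated_sieve \<C> R"
proof
  fix f assume f: "f \<in> R"
  then have "f \<in> Arr \<C>" using assms by blast
  then have "f = f \<cdot> Id \<C> (Dom \<C> f)" "Id \<C> (Dom \<C> f) \<in> Arr \<C>"
      "Dom \<C> f = Cod \<C> (Id \<C> (Dom \<C> f))"
    by (simp_all add: Comp_Id_right Id_closed Cod_Id Dom_closed)
  with f show "f \<in> generated_sieve \<C> R"
    unfolding generated_sieve_def by blast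
qed

text \<open>Closure under precomposition is associativity: \<open>(f \<cdot> g) \<cdot> h = f \<cdot> (g \<cdot> h)\<close> still factors
  through \<open>f \<in> R\<close>.\<close>

lemma generated_sieve_in_sieves:
  assumes R: "R \<in> coverings \<C> X"
  shows "generated_sieve \<C> R \<in> sieves \<C> X"
proof -
  have "generated_sieve \<C> R \<in> coverings \<C> X"
    using R by (auto simp: coverings_def generated_sieve_def Comp_closed Cod_Comp subset_iff)
  moreover have "k \<cdot> h \<in> generated_sieve \<C> R"
    if k: "k \<in> generated_sieve \<C> R" and h: "h \<in> Arr \<C>" "Dom \<C> k = Cod \<C> h" for k h
  proof -
    obtain f g where fg: "k = f \<cdot> g" "f \<in> R" "g \<in> Arr \<C>" "Dom \<C> f = Cod \<C> g"
      using k by (auto simp: generated_sieve_def)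
    have f: "f \<in> Arr \<C>" using fg(2) coverings_subset_Arr[OF R] by blast
    have gh: "Dom \<C> g = Cod \<C> h" using h fg f by (simp add: Dom_Comp)
    have "k \<cdot> h = f \<cdot> (g \<cdot> h)" "g \<cdot> h \<in> Arr \<C>" "Dom \<C> f = Cod \<C> (g \<cdot> h)"
      using f fg h gh by (simp_all add: Comp_assoc Comp_closed Cod_Comp)
    with fg(2) show ?thesis unfolding generated_sieve_def by blast
  qed
  ultimately show ?thesis by (simp add: sieves_def)
qed

text \<open>The universal property of the generated sieve: it is the least sieve containing \<open>R\<close>.\<close>

lemma generated_sieve_subset_iff:
  assumes R: "R \<subseteq> Arr \<C>" and S: "S \<in> sieves \<C> X"
  shows "generated_sieve \<C> R \<subseteq> S \<longleftrightarrow> R \<subseteq> S"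
proof
  assume "R \<subseteq> S"
  then show "generated_sieve \<C> R \<subseteq> S"
    using S by (auto simp: generated_sieve_def sieves_def)
qed (use subset_generated_sieve[OF R] in blast)

lemma generated_sieve_of_sieve:
  assumes S: "S \<in> sieves \<C> X"
  shows "generated_sieve \<C> S = S"
proof -
  have Arr: "S \<subseteq> Arr \<C>" by (rule coverings_subset_Arr[OF sieve_in_coverings[OF S]])
  show ?thesis
    using generated_sieve_subset_iff[OF Arr S] subset_generated_sieve[OF Arr] by simp
qed

lemma sifted_saturation_sieve_closure_at:
  assumes K: "K \<in> covering_functions \<C>" and X: "X \<in> Obj \<C>"
  shows "sifted_saturation \<C> (sieve_closure \<C> K) X = {S \<in> sieves \<C> X. \<exists>R\<in>K X. R \<subseteq> S}"
proof -
  have "generated_sieve \<C> R \<subseteq> S \<longleftrightarrow> R \<subseteq> S" if "R \<in> K X" "S \<in> sieves \<C> X" for R S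
    using generated_sieve_subset_iff[OF coverings_subset_Arr that(2)] covering_functionsD[OF K X that(1)]
    by simp
  then show ?thesis
    using X by (simp add: sifted_saturation_def sieve_closure_def cong: conj_cong bex_cong_simp)
qed

lemma sieve_closure_saturation_at:
  assumes X: "X \<in> Obj \<C>"
  shows "sieve_closure \<C> (saturation \<C> K) X = {S \<in> sieves \<C> X. \<exists>R\<in>K X. R \<subseteq> S}"
    (is "?L = ?R")
proof -
  have L: "?L = generated_sieve \<C> ` {S \<in> coverings \<C> X. \<exists>R\<in>K X. R \<subseteq> generated_sieve \<C> S}"
    using X by (simp add: sieve_closure_def saturation_def refines_iff_subset_generated_sieve)
  show ?thesis
  proof
    show "?L \<subseteq> ?R" unfolding L using generated_sieve_in_sieves by blast
  next
    \<comment> \<open>A sieve is a covering whose generated sieve is itself, so it witnesses its own membership.\<close>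
    show "?R \<subseteq> ?L"
    proof
      fix S assume S: "S \<in> ?R"
      then have eq: "generated_sieve \<C> S = S" by (simp add: generated_sieve_of_sieve[of S X])
      have "S \<in> {S \<in> coverings \<C> X. \<exists>R\<in>K X. R \<subseteq> generated_sieve \<C> S}"
        using S by (simp add: eq sieve_in_coverings)
      then have "generated_sieve \<C> S \<in> ?L" unfolding L by (rule imageI)
      then show "S \<in> ?L" unfolding eq .
    qed
  qed
qed

end

theorem proposition2p2p26:
  fixes \<C> :: "('o, 'a) category" and K :: "'o \<Rightarrow> 'a set set"
  assumes "category \<C>"
    and "K \<in> covering_functions \<C>"
  shows "sifted_saturation \<C> (sieve_closure \<C> K) = sieve_closure \<C> (saturation \<C> K)
    \<and> J_cov \<C> K \<in> sifted_covering_functions \<C>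
    \<and> (\<forall>X\<in>Obj \<C>. \<forall>S\<in>sieves \<C> X. S \<in> J_cov \<C> K X \<longleftrightarrow> (\<exists>R\<in>K X. R \<subseteq> S))
    \<and> (\<forall>J\<in>sifted_covering_functions \<C>.
          (\<forall>X\<in>Obj \<C>. \<forall>S\<in>sieves \<C> X. S \<in> J X \<longleftrightarrow> (\<exists>R\<in>K X. R \<subseteq> S))
          \<longrightarrow> J = J_cov \<C> K)"
proof -
  interpret category \<C> by fact
  note K = assms(2)
  have J: "J_cov \<C> K X = {S \<in> sieves \<C> X. \<exists>R\<in>K X. R \<subseteq> S}" if "X \<in> Obj \<C>" for X
    using sifted_saturation_sieve_closure_at[OF K that] by (simp add: J_cov_def)
  have "sifted_saturation \<C> (sieve_closure \<C> K) = sieve_closure \<C> (saturation \<C> K)"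
  proof
    fix X
    show "sifted_saturation \<C> (sieve_closure \<C> K) X = sieve_closure \<C> (saturation \<C> K) X"
    proof (cases "X \<in> Obj \<C>")
      case True
      then show ?thesis
        using sifted_saturation_sieve_closure_at[OF K] sieve_closure_saturation_at by simp
    next
      case False
      then show ?thesis by (simp add: sifted_saturation_def sieve_closure_def)
    qed
  qed
  moreover have sifted: "J_cov \<C> K \<in> sifted_covering_functions \<C>"
  proof -
    have "J_cov \<C> K \<in> extensional (Obj \<C>)"
      by (simp add: J_cov_def sifted_saturation_def)
    moreover have "J_cov \<C> K X \<subseteq> sieves \<C> X" if "X \<in> Obj \<C>" for X
      using J[OF that] by simp
    ultimately show ?thesis
      by (auto simp: sifted_covering_functions_def covering_functions_def PiE_iff
          dest: sieve_in_coverings)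
  qed
  moreover have "J' = J_cov \<C> K"
    if J': "J' \<in> sifted_covering_functions \<C>"
      and char: "\<forall>X\<in>Obj \<C>. \<forall>S\<in>sieves \<C> X. S \<in> J' X \<longleftrightarrow> (\<exists>R\<in>K X. R \<subseteq> S)" for J'
  proof (rule extensionalityI)
    show "J' \<in> extensional (Obj \<C>)" "J_cov \<C> K \<in> extensional (Obj \<C>)"
      using J' sifted
      by (auto simp: sifted_covering_functions_def covering_functions_def PiE_iff)
    fix X assume X: "X \<in> Obj \<C>"
    then have "J' X \<subseteq> sieves \<C> X"
      using J' by (auto simp: sifted_covering_functions_def)
    then show "J' X = J_cov \<C> K X"
      unfolding J[OF X] using char X by blast
  qed
  moreover have "S \<in> J_cov \<C> K X \<longleftrightarrow> (\<exists>R\<in>K X. R \<subseteq> S)"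
    if "X \<in> Obj \<C>" "S \<in> sieves \<C> X" for X S
    using J[OF that(1)] that(2) by simp
  ultimately show ?thesis by blast
qed

end
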